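(* Let $G=(V,E)$ be a finite connected graph with boundary $B\neq\emptyset$ and non-empty connected interior $\Omega=V\setminus B$, and let $E(\Omega,B)$ be the set of edges joining a vertex of $\Omega$ to a vertex of $B$. Then $$\lambda_1(G,B)\ \leq\ \frac{|E(\Omega,B)|}{|\Omega|}.$$ Equality holds if and only if $|E(\Omega,B)|$ is divisible by $|\Omega|$ and each interior vertex is adjacent to exactly $|E(\Omega,B)|/|\Omega|$ boundary vertices.
   Context: Graphs are finite, undirected and simple. A graph with boundary is a pair $(G,B)$ where $G=(V,E)$ is a graph and $B\subset V$ is such that, with $\Omega:=V\setminus B$ (the interior), (i) $B$ is exactly the set of vertices outside $\Omega$ having at least one neighbor in $\Omega$, and (ii) no edge of $G$ joins two vertices of $B$. It is assumed throughout that $B$ and $\Omega$ are non-empty and that the subgraph induced on $\Omega$ is connected. The first Dirichlet eigenvalue $\lambda_1(G,B)$ is the smallest $\lambda$ for which there is a nonzero $f:V\to\mathbb{R}$ with $f=0$ on $B$ and $\sum_{y\sim x}(f(x)-f(y))=\lambda f(x)$ for all $x\in\Omega$. Equivalently, $\lambda_1(G,B)=\min \frac{\sum_{\{x,y\}\in E}(f(x)-f(y))^2}{\sum_{x\in\Omega}f(x)^2}$ over nonzero $f:V\to\mathbb{R}$ vanishing on $B$. *)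

theory Defs
  imports Complex_Main "Graph_Theory.Digraph_Component"
begin

text \<open>
  A finite simple graph is a \<^locale>\<open>pair_graph\<close>: a finite, loop-free, symmetric set of
  pairs, so that an undirected edge \<open>{x, y}\<close> is the pair of arcs \<open>(x, y)\<close> and \<open>(y, x)\<close>.
\<close>

definition graph_interior :: "'a pair_pre_digraph \<Rightarrow> 'a set \<Rightarrow> 'a set" where
  "graph_interior G B = pverts G - B"

locale graph_with_boundary = pair_graph G for G :: "'a pair_pre_digraph" +
  fixes B :: "'a set"
  assumes boundary_subset: "B \<subseteq> pverts G"
    and boundary_eq: "B = {x \<in> pverts G - graph_interior G B.
      \<exists>y \<in> graph_interior G B. (x, y) \<in> parcs G}"
    and boundary_independent: "\<And>x y. x \<in> B \<Longrightarrow> y \<in> B \<Longrightarrow> (x, y) \<notin> parcs G"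
    and boundary_nonempty: "B \<noteq> {}"
    and interior_nonempty: "graph_interior G B \<noteq> {}"
    and interior_connected:
      "Digraph_Component.connected (with_proj G \<restriction> graph_interior G B)"

text \<open>
  A function on the vertex set is represented by a function on the whole type; its values outside
  \<^term>\<open>pverts G\<close> play no role, and being nonzero means being nonzero somewhere on
  \<^term>\<open>pverts G\<close>.
\<close>

definition dirichlet_eigenvalue :: "'a pair_pre_digraph \<Rightarrow> 'a set \<Rightarrow> real \<Rightarrow> bool" where
  "dirichlet_eigenvalue G B \<mu> \<longleftrightarrow> (\<exists>f :: 'a \<Rightarrow> real.
     (\<exists>x \<in> pverts G. f x \<noteq> 0) \<and>
     (\<forall>x \<in> B. f x = 0) \<and>
     (\<forall>x \<in> graph_interior G B. (\<Sum>y | (x, y) \<in> parcs G. f x - f y) = \<mu> * f x))"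

definition first_dirichlet_eigenvalue :: "'a pair_pre_digraph \<Rightarrow> 'a set \<Rightarrow> real" where
  "first_dirichlet_eigenvalue G B = (LEAST \<mu>. dirichlet_eigenvalue G B \<mu>)"

definition boundary_edges :: "'a pair_pre_digraph \<Rightarrow> 'a set \<Rightarrow> 'a set set" where
  "boundary_edges G B =
     {{x, y} | x y. x \<in> graph_interior G B \<and> y \<in> B \<and> (x, y) \<in> parcs G}"

end

theory Submission
  imports Defs "HOL-Analysis.Function_Topology"
begin

text \<open>
  The Dirichlet Laplacian is a symmetric matrix on the interior, so its least eigenvalue is the
  minimum of the Rayleigh quotient, and every minimizer is an eigenfunction. The indicator of the
  interior has Rayleigh quotient \<open>|E(\<Omega>, B)| / |\<Omega>|\<close>, which gives the bound. In case of equality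
  this indicator is an eigenfunction, so all interior vertices have the same number of boundary
  neighbours. Conversely, discarding the edges inside the interior bounds the quadratic form from
  below by the number of boundary neighbours, weighted by the squared function.
\<close>

section \<open>The least eigenvalue of a symmetric matrix\<close>

definition bilinear_form :: "'a set \<Rightarrow> ('a \<Rightarrow> 'a \<Rightarrow> real) \<Rightarrow> ('a \<Rightarrow> real) \<Rightarrow> ('a \<Rightarrow> real) \<Rightarrow> real" where
  "bilinear_form S M f g = (\<Sum>x\<in>S. \<Sum>y\<in>S. M x y * f x * g y)"

lemma bilinear_form_cong:
  assumes "\<And>x. x \<in> S \<Longrightarrow> f x = f' x" "\<And>x. x \<in> S \<Longrightarrow> g x = g' x"
  shows "bilinear_form S M f g = bilinear_form S M f' g'"
  using assms by (simp add: bilinear_form_def)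

lemma bilinear_form_scale:
  "bilinear_form S M (\<lambda>x. c * f x) (\<lambda>x. c * f x) = c\<^sup>2 * bilinear_form S M f f"
  by (simp add: bilinear_form_def sum_distrib_left power2_eq_square mult_ac)

lemma bilinear_form_commute:
  assumes "\<And>x y. x \<in> S \<Longrightarrow> y \<in> S \<Longrightarrow> M x y = M y x"
  shows "bilinear_form S M f g = bilinear_form S M g f"
  unfolding bilinear_form_def
  by (subst sum.swap) (auto intro!: sum.cong simp: assms)

text \<open>Expansion along a line through \<open>f\<close> for the first variation; symmetry merges
  the two mixed terms.\<close>

lemma bilinear_form_add_scaled:
  assumes "\<And>x y. x \<in> S \<Longrightarrow> y \<in> S \<Longrightarrow> M x y = M y x"
  shows "bilinear_form S M (\<lambda>x. f x + t * g x) (\<lambda>x. f x + t * g x) =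
    bilinear_form S M f f + 2 * t * bilinear_form S M g f + t\<^sup>2 * bilinear_form S M g g"
proof -
  have "bilinear_form S M (\<lambda>x. f x + t * g x) (\<lambda>x. f x + t * g x) =
    bilinear_form S M f f + t * bilinear_form S M g f + t * bilinear_form S M f g
      + t\<^sup>2 * bilinear_form S M g g"
    unfolding bilinear_form_def
    by (simp add: sum_distrib_left sum.distrib algebra_simps power2_eq_square)
  then show ?thesis
    using bilinear_form_commute[of S M f g] assms by simp
qed

text \<open>Testing against a point indicator reads off one coordinate of the matrix-vector product,
  turning a variational identity into an eigenvalue equation.\<close>

lemma bilinear_form_indicator:
  assumes "finite S" "x \<in> S"
  shows "bilinear_form S M (indicator {x}) g = (\<Sum>y\<in>S. M x y * g y)"
proof -
  have "bilinear_form S M (indicator {x}) g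
      = (\<Sum>z\<in>S. if z = x then \<Sum>y\<in>S. M x y * g y else 0)"
    unfolding bilinear_form_def by (auto intro!: sum.cong)
  with assms show ?thesis by simp
qed

lemma bilinear_form_eigenvector:
  assumes "\<And>x. x \<in> S \<Longrightarrow> (\<Sum>y\<in>S. M x y * f y) = m * f x"
  shows "bilinear_form S M f f = m * (\<Sum>x\<in>S. (f x)\<^sup>2)"
proof -
  have "bilinear_form S M f f = (\<Sum>x\<in>S. f x * (\<Sum>y\<in>S. M x y * f y))"
    by (simp add: bilinear_form_def sum_distrib_left mult_ac)
  also have "\<dots> = m * (\<Sum>x\<in>S. (f x)\<^sup>2)"
    using assms by (simp add: sum_distrib_left power2_eq_square mult_ac)
  finally show ?thesis .
qed

section \<open>Existence of a Rayleigh minimizer by compactness\<close>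

text \<open>Functions live on the whole, possibly infinite, type with the product topology.
  Tychonoff gives compactness of a box containing the sphere, and the sphere equation is closed
  because it involves finitely many coordinates.\<close>

lemma compact_supported_unit_sphere:
  fixes S :: "'a set"
  assumes "finite S"
  shows "compact {f :: 'a \<Rightarrow> real. (\<forall>x. x \<notin> S \<longrightarrow> f x = 0) \<and> (\<Sum>x\<in>S. (f x)\<^sup>2) = 1}"
    (is "compact ?K")
proof -
  \<comment> \<open>The singleton factors encode the support condition, so only the norm equation
    remains to be intersected.\<close>
  define C where "C x = (if x \<in> S then {-1..1::real} else {0})" for x
  have "compact (PiE UNIV C)"
    using compactin_PiE[of "\<lambda>_. euclidean" UNIV C]
    by (simp add: euclidean_product_topology C_def)
  moreover have "closed {f :: 'a \<Rightarrow> real. (\<Sum>x\<in>S. (f x)\<^sup>2) = 1}"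
    by (intro closed_Collect_eq continuous_intros) auto
  ultimately have "compact (PiE UNIV C \<inter> {f. (\<Sum>x\<in>S. (f x)\<^sup>2) = 1})"
    by (rule compact_Int_closed)
  moreover have "f x \<in> C x" if "f \<in> ?K" for f x
  proof (cases "x \<in> S")
    case True
    then have "(f x)\<^sup>2 \<le> (\<Sum>x\<in>S. (f x)\<^sup>2)"
      using assms by (intro member_le_sum) auto
    with that have "\<bar>f x\<bar> \<le> 1" by (simp add: abs_square_le_1)
    with True show ?thesis by (auto simp: C_def)
  qed (use that in \<open>auto simp: C_def\<close>)
  then have "PiE UNIV C \<inter> {f. (\<Sum>x\<in>S. (f x)\<^sup>2) = 1} = ?K"
    by (auto simp: PiE_UNIV_domain C_def Pi_iff split: if_splits)
  ultimately show ?thesis by simp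
qed

text \<open>A continuous form attains its minimum on the compact sphere; homogeneity of degree 2
  extends the inequality to every \<open>g\<close>.\<close>

lemma ex_rayleigh_minimizer:
  fixes S :: "'a set"
  assumes "finite S" "S \<noteq> {}"
  obtains u where "(\<Sum>x\<in>S. (u x)\<^sup>2) = 1"
    and "\<And>g. bilinear_form S M u u * (\<Sum>x\<in>S. (g x)\<^sup>2) \<le> bilinear_form S M g g"
proof -
  let ?K = "{f :: 'a \<Rightarrow> real. (\<forall>x. x \<notin> S \<longrightarrow> f x = 0) \<and> (\<Sum>x\<in>S. (f x)\<^sup>2) = 1}"
  obtain a where "a \<in> S" using assms by auto
  have "(\<Sum>x\<in>S. (indicator {a} x :: real)\<^sup>2) = (\<Sum>x\<in>S. if x = a then 1 else 0)"
    by (intro sum.cong) auto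
  with \<open>a \<in> S\<close> \<open>finite S\<close> have "indicator {a} \<in> ?K"
    by (auto simp: indicator_def)
  then have "?K \<noteq> {}" by blast
  moreover have "continuous_on UNIV (\<lambda>f. bilinear_form S M f f)"
    unfolding bilinear_form_def
    by (intro continuous_on_sum continuous_on_mult continuous_on_const
        continuous_on_product_coordinates)
  then have "continuous_on ?K (\<lambda>f. bilinear_form S M f f)"
    using continuous_on_subset by blast
  ultimately have "\<exists>u\<in>?K. \<forall>f\<in>?K. bilinear_form S M u u \<le> bilinear_form S M f f"
    by (rule continuous_attains_inf[OF compact_supported_unit_sphere[OF \<open>finite S\<close>]])
  then obtain u where u: "u \<in> ?K"
    and min: "\<forall>f\<in>?K. bilinear_form S M u u \<le> bilinear_form S M f f" ..
  show ?thesis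
  proof (rule that)
    show "(\<Sum>x\<in>S. (u x)\<^sup>2) = 1" using u by simp
    fix g :: "'a \<Rightarrow> real"
    define N where "N = (\<Sum>x\<in>S. (g x)\<^sup>2)"
    show "bilinear_form S M u u * (\<Sum>x\<in>S. (g x)\<^sup>2) \<le> bilinear_form S M g g"
    proof (cases "N = 0")
      case True
      then have "\<And>x. x \<in> S \<Longrightarrow> g x = 0"
        using \<open>finite S\<close> by (simp add: N_def sum_nonneg_eq_0_iff)
      then show ?thesis by (simp add: bilinear_form_def)
    next
      case False
      then have "N > 0"
        using sum_nonneg[of S "\<lambda>x. (g x)\<^sup>2"] by (simp add: N_def less_le)
      define c where "c = 1 / sqrt N"
      have c: "c\<^sup>2 = 1 / N"
        using \<open>N > 0\<close> by (simp add: c_def power_divide)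
      \<comment> \<open>Normalizing is not enough for membership in \<open>?K\<close>:
        \<open>g\<close> must also be cut off outside \<open>S\<close>, which the form does not
        see.\<close>
      define h where "h x = (if x \<in> S then c * g x else 0)" for x
      have "(\<Sum>x\<in>S. (h x)\<^sup>2) = c\<^sup>2 * N"
        by (simp add: h_def N_def sum_distrib_left power_mult_distrib)
      with c \<open>N > 0\<close> have "h \<in> ?K"
        by (simp add: h_def)
      then have "bilinear_form S M u u \<le> bilinear_form S M h h"
        by (rule bspec[OF min])
      also have "bilinear_form S M h h = c\<^sup>2 * bilinear_form S M g g"
        by (subst bilinear_form_scale[symmetric]) (auto intro: bilinear_form_cong simp: h_def)
      finally show ?thesis
        using \<open>N > 0\<close> by (simp add: c field_simps flip: N_def)
    qed
  qed
qed

section \<open>First-order condition at a minimizer\<close>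

lemma linear_term_zero_if_quadratic_nonneg:
  fixes a b :: real
  assumes "\<And>t. 0 \<le> 2 * t * a + t\<^sup>2 * b"
  shows "a = 0"
proof (rule ccontr)
  assume "a \<noteq> 0"
  \<comment> \<open>This makes \<open>c\<close> positive and \<open>b / c < 1\<close> whatever the
    sign of \<open>b\<close>, so at \<open>t = - a / c\<close> the linear term beats the quadratic
    one.\<close>
  define c where "c = \<bar>b\<bar> + 1"
  have "c > 0" "b < c" by (auto simp: c_def)
  have "0 \<le> 2 * (- a / c) * a + (- a / c)\<^sup>2 * b" by (rule assms)
  also have "\<dots> = a\<^sup>2 / c * (b / c - 2)"
    using \<open>c > 0\<close> by (simp add: field_simps power2_eq_square)
  also have "\<dots> < 0"
    using \<open>a \<noteq> 0\<close> \<open>c > 0\<close> \<open>b < c\<close> by (intro mult_pos_neg) (auto simp: field_simps)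
  finally show False by simp
qed

text \<open>The form minus \<open>m\<close> times the squared norm is nonnegative and vanishes at
  \<open>u\<close>, so its derivative at \<open>u\<close> in each coordinate direction is zero. As
  \<open>u\<close> is not normalized, the constant 1 can be inserted later.\<close>

lemma rayleigh_minimizer_eigenvector:
  assumes "finite S" "x \<in> S"
    and sym: "\<And>x y. x \<in> S \<Longrightarrow> y \<in> S \<Longrightarrow> M x y = M y x"
    and min: "\<And>g. m * (\<Sum>x\<in>S. (g x)\<^sup>2) \<le> bilinear_form S M g g"
    and eq: "bilinear_form S M u u = m * (\<Sum>x\<in>S. (u x)\<^sup>2)"
  shows "(\<Sum>y\<in>S. M x y * u y) = m * u x"
proof -
  define e :: "'a \<Rightarrow> real" where "e = indicator {x}"
  \<comment> \<open>With the identity matrix the squared norm is a bilinear form too, so one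
    expansion serves both sides.\<close>
  define I :: "'a \<Rightarrow> 'a \<Rightarrow> real" where "I y z = (if y = z then 1 else 0)" for y z
  have I: "bilinear_form S I g g = (\<Sum>x\<in>S. (g x)\<^sup>2)" for g
    using \<open>finite S\<close>
    by (simp add: bilinear_form_def I_def power2_eq_square if_distrib[of "\<lambda>c. c * _"] cong: if_cong)
  have "0 \<le> 2 * t * (bilinear_form S M e u - m * bilinear_form S I e u)
      + t\<^sup>2 * (bilinear_form S M e e - m * bilinear_form S I e e)" for t
  proof -
    have "m * bilinear_form S I (\<lambda>y. u y + t * e y) (\<lambda>y. u y + t * e y)
      \<le> bilinear_form S M (\<lambda>y. u y + t * e y) (\<lambda>y. u y + t * e y)"
      using min by (simp add: I)
    then show ?thesis
      using eq sym by (simp add: bilinear_form_add_scaled I_def I[symmetric] algebra_simps)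
  qed
  then have "bilinear_form S M e u = m * bilinear_form S I e u"
    using linear_term_zero_if_quadratic_nonneg by fastforce
  moreover have "(\<Sum>y\<in>S. I x y * u y) = u x"
    using assms(1,2) by (simp add: I_def if_distrib[of "\<lambda>c. c * _"] cong: if_cong)
  ultimately show ?thesis
    using assms(1,2) by (simp add: e_def bilinear_form_indicator)
qed

section \<open>The Dirichlet Laplacian\<close>

context graph_with_boundary
begin

definition boundary_degree :: "'a \<Rightarrow> nat" where
  "boundary_degree x = card {y \<in> B. (x, y) \<in> parcs G}"

definition adjacency :: "'a \<Rightarrow> 'a \<Rightarrow> real" where
  "adjacency x y = (if (x, y) \<in> parcs G then 1 else 0)"

text \<open>The graph Laplacian with boundary rows and columns deleted. The diagonal holds the full
  degree, split to keep the boundary part visible.\<close>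

definition dirichlet_matrix :: "'a \<Rightarrow> 'a \<Rightarrow> real" where
  "dirichlet_matrix x y =
    (if x = y then real (boundary_degree x) + (\<Sum>z\<in>graph_interior G B. adjacency x z) else 0)
      - adjacency x y"

abbreviation "dirichlet_form \<equiv> bilinear_form (graph_interior G B) dirichlet_matrix"

lemma finite_interior: "finite (graph_interior G B)"
  by (simp add: graph_interior_def pair_finite_verts)

lemma finite_boundary: "finite B"
  using boundary_subset pair_finite_verts finite_subset by blast

lemma interior_boundary_disjoint: "graph_interior G B \<inter> B = {}"
  by (auto simp: graph_interior_def)

lemma adjacency_commute: "adjacency x y = adjacency y x"
  using arcs_symmetric by (auto simp: adjacency_def)

lemma dirichlet_matrix_commute: "dirichlet_matrix x y = dirichlet_matrix y x"
  using adjacency_commute by (simp add: dirichlet_matrix_def)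

lemma dirichlet_matrix_apply:
  assumes "x \<in> graph_interior G B"
  shows "(\<Sum>y\<in>graph_interior G B. dirichlet_matrix x y * f y) =
    real (boundary_degree x) * f x + (\<Sum>y\<in>graph_interior G B. adjacency x y * (f x - f y))"
proof -
  let ?S = "graph_interior G B"
  define d where "d = real (boundary_degree x) + (\<Sum>z\<in>?S. adjacency x z)"
  have "dirichlet_matrix x y * f y = (if x = y then d * f y else 0) - adjacency x y * f y" for y
    by (simp add: dirichlet_matrix_def d_def left_diff_distrib)
  then have "(\<Sum>y\<in>?S. dirichlet_matrix x y * f y) = d * f x - (\<Sum>y\<in>?S. adjacency x y * f y)"
    using assms finite_interior by (simp add: sum_subtractf)
  then show ?thesis
    by (simp add: d_def distrib_right right_diff_distrib sum_subtractf sum_distrib_right)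
qed

text \<open>Each boundary neighbour contributes \<open>f x - 0\<close>; together they give the
  boundary part of the diagonal.\<close>

lemma laplacian_eq_dirichlet_matrix_apply:
  assumes "x \<in> graph_interior G B" and "\<And>y. y \<in> B \<Longrightarrow> f y = 0"
  shows "(\<Sum>y | (x, y) \<in> parcs G. f x - f y)
    = (\<Sum>y\<in>graph_interior G B. dirichlet_matrix x y * f y)"
proof -
  have split: "{y. (x, y) \<in> parcs G}
      = {y \<in> B. (x, y) \<in> parcs G} \<union> {y \<in> graph_interior G B. (x, y) \<in> parcs G}"
    using in_arcsD2 by (auto simp: graph_interior_def)
  have "(\<Sum>y | (x, y) \<in> parcs G. f x - f y)
      = (\<Sum>y | y \<in> B \<and> (x, y) \<in> parcs G. f x - f y)
        + (\<Sum>y | y \<in> graph_interior G B \<and> (x, y) \<in> parcs G. f x - f y)"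
    unfolding split using finite_boundary finite_interior interior_boundary_disjoint
    by (intro sum.union_disjoint) auto
  also have "(\<Sum>y | y \<in> B \<and> (x, y) \<in> parcs G. f x - f y) = real (boundary_degree x) * f x"
    using assms(2) by (simp add: boundary_degree_def)
  also have "(\<Sum>y | y \<in> graph_interior G B \<and> (x, y) \<in> parcs G. f x - f y)
      = (\<Sum>y\<in>graph_interior G B. adjacency x y * (f x - f y))"
    using finite_interior
    by (simp add: sum.inter_filter adjacency_def if_distrib[of "\<lambda>c. c * _"] cong: if_cong)
  finally show ?thesis
    using assms(1) by (simp add: dirichlet_matrix_apply)
qed

text \<open>Averaging the interior sum with its copy under exchange of \<open>x\<close> and
  \<open>y\<close> completes the squares. Ordered pairs count each edge twice, hence the factor
  1/2.\<close>

lemma dirichlet_form_eq: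
  "dirichlet_form f f = (\<Sum>x\<in>graph_interior G B. real (boundary_degree x) * (f x)\<^sup>2)
    + (\<Sum>x\<in>graph_interior G B. \<Sum>y\<in>graph_interior G B. adjacency x y * (f x - f y)\<^sup>2) / 2"
proof -
  let ?S = "graph_interior G B"
  define T where "T = (\<Sum>x\<in>?S. \<Sum>y\<in>?S. adjacency x y * (f x * (f x - f y)))"
  have "dirichlet_form f f = (\<Sum>x\<in>?S. f x * (\<Sum>y\<in>?S. dirichlet_matrix x y * f y))"
    by (simp add: bilinear_form_def sum_distrib_left mult_ac)
  also have "\<dots> = (\<Sum>x\<in>?S. real (boundary_degree x) * (f x)\<^sup>2) + T"
    unfolding T_def sum.distrib[symmetric]
  proof (rule sum.cong)
    fix x
    assume "x \<in> ?S"
    show "f x * (\<Sum>y\<in>?S. dirichlet_matrix x y * f y) = real (boundary_degree x) * (f x)\<^sup>2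
        + (\<Sum>y\<in>?S. adjacency x y * (f x * (f x - f y)))"
      unfolding dirichlet_matrix_apply[OF \<open>x \<in> ?S\<close>]
      by (simp add: distrib_left sum_distrib_left power2_eq_square mult_ac)
  qed simp
  finally have "dirichlet_form f f = (\<Sum>x\<in>?S. real (boundary_degree x) * (f x)\<^sup>2) + T" .
  moreover have "T = (\<Sum>x\<in>?S. \<Sum>y\<in>?S. adjacency x y * (f y * (f y - f x)))"
    unfolding T_def by (subst sum.swap) (simp add: adjacency_commute)
  then have "T + T = (\<Sum>x\<in>?S. \<Sum>y\<in>?S. adjacency x y * (f x - f y)\<^sup>2)"
    by (subst (1) T_def)
      (simp add: power2_eq_square algebra_simps flip: sum.distrib)
  ultimately show ?thesis by simp
qed

text \<open>Since interior and boundary are disjoint, each such edge determines its interior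
  endpoint, and edges can be counted there.\<close>

lemma card_boundary_edges:
  "card (boundary_edges G B) = (\<Sum>x\<in>graph_interior G B. boundary_degree x)"
proof -
  let ?P = "SIGMA x : graph_interior G B. {y \<in> B. (x, y) \<in> parcs G}"
  have "boundary_edges G B = (\<lambda>(x, y). {x, y}) ` ?P"
    by (auto simp: boundary_edges_def image_def)
  moreover have "inj_on (\<lambda>(x, y). {x, y}) ?P"
    using interior_boundary_disjoint by (auto simp: inj_on_def doubleton_eq_iff)
  ultimately have "card (boundary_edges G B) = card ?P"
    by (simp add: card_image)
  then show ?thesis
    using finite_interior finite_boundary by (simp add: boundary_degree_def)
qed

section \<open>The first eigenvalue as a Rayleigh minimum\<close>

text \<open>The minimum is itself an eigenvalue and bounds every eigenvalue from below, so the
  \<open>LEAST\<close> is attained and equals it.\<close>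

lemma first_dirichlet_eigenvalue_minimizer:
  obtains u where "(\<Sum>x\<in>graph_interior G B. (u x)\<^sup>2) = 1"
    and "dirichlet_form u u = first_dirichlet_eigenvalue G B"
    and "\<And>g. first_dirichlet_eigenvalue G B * (\<Sum>x\<in>graph_interior G B. (g x)\<^sup>2)
      \<le> dirichlet_form g g"
proof -
  let ?S = "graph_interior G B"
  obtain u where u: "(\<Sum>x\<in>?S. (u x)\<^sup>2) = 1"
    and min: "\<And>g. dirichlet_form u u * (\<Sum>x\<in>?S. (g x)\<^sup>2) \<le> dirichlet_form g g"
    using ex_rayleigh_minimizer[OF finite_interior interior_nonempty] by metis
  define m where "m = dirichlet_form u u"
  have "first_dirichlet_eigenvalue G B = m"
    unfolding first_dirichlet_eigenvalue_def
  proof (rule Least_equality)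
    \<comment> \<open>The minimizer is controlled only on the interior; extension by zero enforces
      the boundary condition.\<close>
    define v where "v x = (if x \<in> ?S then u x else 0)" for x
    have "\<exists>x\<in>?S. u x \<noteq> 0"
      using u by (metis (no_types, lifting) sum.neutral zero_neq_one zero_power2)
    then have "\<exists>x\<in>pverts G. v x \<noteq> 0"
      by (auto simp: v_def graph_interior_def)
    moreover have v0: "\<forall>x\<in>B. v x = 0"
      using interior_boundary_disjoint by (auto simp: v_def)
    moreover have "(\<Sum>y | (x, y) \<in> parcs G. v x - v y) = m * v x" if "x \<in> ?S" for x
    proof -
      have "(\<Sum>y\<in>?S. dirichlet_matrix x y * u y) = m * u x"
        using finite_interior that dirichlet_matrix_commute
      proof (rule rayleigh_minimizer_eigenvector)
        show "m * (\<Sum>x\<in>?S. (g x)\<^sup>2) \<le> dirichlet_form g g" for g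
          using min by (simp add: m_def)
      qed (simp add: u m_def)
      then show ?thesis
        using that v0 by (simp add: laplacian_eq_dirichlet_matrix_apply) (simp add: v_def)
    qed
    ultimately show "dirichlet_eigenvalue G B m"
      unfolding dirichlet_eigenvalue_def by blast
  next
    fix \<mu>
    assume "dirichlet_eigenvalue G B \<mu>"
    then obtain f where f: "\<exists>x\<in>pverts G. f x \<noteq> 0" "\<And>x. x \<in> B \<Longrightarrow> f x = 0"
      and eig: "\<And>x. x \<in> ?S \<Longrightarrow> (\<Sum>y | (x, y) \<in> parcs G. f x - f y) = \<mu> * f x"
      unfolding dirichlet_eigenvalue_def by blast
    have "dirichlet_form f f = \<mu> * (\<Sum>x\<in>?S. (f x)\<^sup>2)"
      using eig f(2) by (intro bilinear_form_eigenvector) (simp add: laplacian_eq_dirichlet_matrix_apply)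
    then have "m * (\<Sum>x\<in>?S. (f x)\<^sup>2) \<le> \<mu> * (\<Sum>x\<in>?S. (f x)\<^sup>2)"
      using min[of f] by (simp add: m_def)
    \<comment> \<open>As \<open>f\<close> vanishes on \<open>B\<close>, it is nonzero somewhere in
      the interior, so the squared norm can be cancelled.\<close>
    moreover obtain a where "a \<in> ?S" "f a \<noteq> 0"
      using f by (auto simp: graph_interior_def)
    then have "(\<Sum>x\<in>?S. (f x)\<^sup>2) > 0"
      using finite_interior by (intro sum_pos2[of _ a]) auto
    ultimately show "m \<le> \<mu>" by simp
  qed
  with u min show ?thesis by (intro that[of u]) (auto simp: m_def)
qed

section \<open>The bound and its equality case\<close>

text \<open>The form reads interior values only, so the constant 1 stands for the indicator of the
  interior; all interior differences vanish.\<close>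

lemma dirichlet_form_one: "dirichlet_form (\<lambda>_. 1) (\<lambda>_. 1) = real (card (boundary_edges G B))"
  by (simp add: dirichlet_form_eq card_boundary_edges)

lemma card_interior_pos: "card (graph_interior G B) > 0"
  using finite_interior interior_nonempty by (simp add: card_gt_0_iff)

theorem first_dirichlet_eigenvalue_le:
  "first_dirichlet_eigenvalue G B
    \<le> real (card (boundary_edges G B)) / real (card (graph_interior G B))"
proof -
  have "first_dirichlet_eigenvalue G B * (\<Sum>x\<in>graph_interior G B. 1\<^sup>2)
      \<le> dirichlet_form (\<lambda>_. 1) (\<lambda>_. 1)"
    by (rule first_dirichlet_eigenvalue_minimizer)
  then show ?thesis
    using card_interior_pos by (simp add: dirichlet_form_one field_simps)
qed

text \<open>Equality makes the constant 1 a minimizer, hence an eigenvector, and the row sums of the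
  matrix are the boundary degrees.\<close>

lemma boundary_degree_eq_first_dirichlet_eigenvalue:
  assumes "first_dirichlet_eigenvalue G B
      = real (card (boundary_edges G B)) / real (card (graph_interior G B))"
    and "x \<in> graph_interior G B"
  shows "real (boundary_degree x) = first_dirichlet_eigenvalue G B"
proof -
  let ?m = "first_dirichlet_eigenvalue G B"
  have "(\<Sum>y\<in>graph_interior G B. dirichlet_matrix x y * 1) = ?m * 1"
    using finite_interior assms(2) dirichlet_matrix_commute
  proof (rule rayleigh_minimizer_eigenvector)
    show "?m * (\<Sum>x\<in>graph_interior G B. (g x)\<^sup>2) \<le> dirichlet_form g g" for g
      by (rule first_dirichlet_eigenvalue_minimizer)
    show "dirichlet_form (\<lambda>_. 1) (\<lambda>_. 1) = ?m * (\<Sum>x\<in>graph_interior G B. 1\<^sup>2)"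
      using assms(1) card_interior_pos by (simp add: dirichlet_form_one)
  qed
  then show ?thesis
    by (subst (asm) dirichlet_matrix_apply) (simp_all add: assms(2))
qed

text \<open>Applied to a normalized minimizer, the form dominates its boundary term because the
  interior energy is nonnegative.\<close>

lemma first_dirichlet_eigenvalue_ge:
  assumes "\<And>x. x \<in> graph_interior G B \<Longrightarrow> k \<le> boundary_degree x"
  shows "real k \<le> first_dirichlet_eigenvalue G B"
proof -
  let ?S = "graph_interior G B"
  obtain u where u: "(\<Sum>x\<in>?S. (u x)\<^sup>2) = 1"
    and eq: "dirichlet_form u u = first_dirichlet_eigenvalue G B"
    by (rule first_dirichlet_eigenvalue_minimizer)
  have "real k = (\<Sum>x\<in>?S. real k * (u x)\<^sup>2)"
    using u by (simp flip: sum_distrib_left)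
  also have "\<dots> \<le> (\<Sum>x\<in>?S. real (boundary_degree x) * (u x)\<^sup>2)"
    using assms by (intro sum_mono mult_right_mono) auto
  also have "\<dots> \<le> dirichlet_form u u"
    unfolding dirichlet_form_eq by (simp add: sum_nonneg adjacency_def)
  finally show ?thesis by (simp add: eq)
qed

end

theorem theorem1p4:
  fixes G :: "'a pair_pre_digraph" and B :: "'a set"
  assumes "graph_with_boundary G B"
    and "Digraph_Component.connected (with_proj G)"
  shows "first_dirichlet_eigenvalue G B
           \<le> real (card (boundary_edges G B)) / real (card (graph_interior G B)) \<and>
         (first_dirichlet_eigenvalue G B
           = real (card (boundary_edges G B)) / real (card (graph_interior G B)) \<longleftrightarrow>
          card (graph_interior G B) dvd card (boundary_edges G B) \<and>
          (\<forall>x \<in> graph_interior G B. card {y \<in> B. (x, y) \<in> parcs G}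
             = card (boundary_edges G B) div card (graph_interior G B)))"
proof -
  interpret graph_with_boundary G B by fact
  let ?S = "graph_interior G B"
  let ?m = "first_dirichlet_eigenvalue G B"
  let ?q = "real (card (boundary_edges G B)) / real (card ?S)"
  let ?k = "card (boundary_edges G B) div card ?S"
  have "card ?S dvd card (boundary_edges G B) \<and> (\<forall>x\<in>?S. boundary_degree x = ?k)"
    if eq: "?m = ?q"
  proof -
    obtain a where "a \<in> ?S" using interior_nonempty by blast
    have deg: "boundary_degree x = boundary_degree a" if "x \<in> ?S" for x
      using boundary_degree_eq_first_dirichlet_eigenvalue[OF eq] that \<open>a \<in> ?S\<close>
      by (metis of_nat_eq_iff)
    \<comment> \<open>Summing the common degree yields both the divisibility and the value of the
      quotient.\<close>
    then have "card (boundary_edges G B) = card ?S * boundary_degree a"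
      by (simp add: card_boundary_edges)
    with deg card_interior_pos show ?thesis by simp
  qed
  moreover have "?m = ?q"
    if dvd: "card ?S dvd card (boundary_edges G B)" and deg: "\<forall>x\<in>?S. boundary_degree x = ?k"
  proof (rule antisym)
    \<comment> \<open>Divisibility identifies the natural-number quotient \<open>?k\<close> with the
      real quotient \<open>?q\<close>.\<close>
    show "?q \<le> ?m"
      using first_dirichlet_eigenvalue_ge[of ?k] deg dvd by (simp add: real_of_nat_div)
  qed (rule first_dirichlet_eigenvalue_le)
  ultimately show ?thesis
    using first_dirichlet_eigenvalue_le unfolding boundary_degree_def by blast
qed

end
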